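(* For every discrete subset $M\subset\mathbb{R}^2$, the set $\mathrm{E}(M)$ of exceptional directions for $M$ is a meager subset of $\mathbb{T}=[0,2\pi)$ of Lebesgue measure $0$.
   Context: A set $M\subset\mathbb{R}^n$ is called discrete if $M\cap\{\mathbf{x}\in\mathbb{R}^n : \|\mathbf{x}\|\le r\}$ is finite for every $r>0$ (this is used for $n=1$ and $n=2$). Let $\mathbb{T}=[0,2\pi)$ be the set of directions (parametrizing the unit circle by $\alpha\mapsto(\cos\alpha,\sin\alpha)$). For $\alpha\in\mathbb{T}$ define $\Phi_\alpha:\mathbb{R}^2\to\mathbb{R}$ by $\Phi_\alpha(x_1,x_2)=x_1\cos\alpha+x_2\sin\alpha$. For $M\subset\mathbb{R}^2$ put $\mathrm{DEN}(M)=\{\alpha\in\mathbb{T} : \Phi_\alpha(M)\text{ is dense in }\mathbb{R}\}$, $\mathrm{DIS}(M)=\{\alpha\in\mathbb{T} : \Phi_\alpha(M)\text{ is a discrete subset of }\mathbb{R}\}$, and $\mathrm{E}(M)=\mathbb{T}\setminus(\mathrm{DEN}(M)\cup\mathrm{DIS}(M))$ (the exceptional directions). *)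

theory Defs
  imports "HOL-Analysis.Analysis"
begin

(* Local finiteness, which is stronger than carrying the discrete subspace topology:
   a discrete set in this sense has no accumulation point anywhere in the space. *)
definition discrete_set :: "'a::euclidean_space set \<Rightarrow> bool" where
  "discrete_set M \<longleftrightarrow> (\<forall>r>0. finite (M \<inter> {x. norm x \<le> r}))"

definition directions :: "real set" where
  "directions = {0..<2 * pi}"

definition Phi :: "real \<Rightarrow> real ^ 2 \<Rightarrow> real" where
  "Phi \<alpha> x = x $ 1 * cos \<alpha> + x $ 2 * sin \<alpha>"

definition DEN :: "(real ^ 2) set \<Rightarrow> real set" where
  "DEN M = {\<alpha> \<in> directions. closure (Phi \<alpha> ` M) = UNIV}"

definition DIS :: "(real ^ 2) set \<Rightarrow> real set" where
  "DIS M = {\<alpha> \<in> directions. discrete_set (Phi \<alpha> ` M)}"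

definition exceptional :: "(real ^ 2) set \<Rightarrow> real set" where
  "exceptional M = directions - (DEN M \<union> DIS M)"

definition nowhere_dense_in :: "'a topology \<Rightarrow> 'a set \<Rightarrow> bool" where
  "nowhere_dense_in X N \<longleftrightarrow> N \<subseteq> topspace X \<and> X interior_of (X closure_of N) = {}"

definition meager_in :: "'a topology \<Rightarrow> 'a set \<Rightarrow> bool" where
  "meager_in X S \<longleftrightarrow>
     (\<exists>\<N>. countable \<N> \<and> (\<forall>N\<in>\<N>. nowhere_dense_in X N) \<and> S = \<Union>\<N>)"

end

theory Submission
  imports Defs
begin

text \<open>
  If \<alpha> is exceptional, the projection of M in direction \<alpha> misses some interval I with rational
  endpoints while infinitely many points x of M project into some bounded interval J. For such an
  x of large norm R, the function \<open>\<beta> \<mapsto> \<Phi>\<^sub>\<beta>(x)\<close> has slope comparable to R near \<alpha>, so at distance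
  \<open>O(1/R)\<close> from \<alpha> there is an interval of length comparable to \<open>1/R\<close> of directions \<beta> with
  \<open>\<Phi>\<^sub>\<beta>(x) \<in> I\<close>. Hence the closed set of directions whose projections miss I is
  porous at \<alpha>, with a constant depending only on I and J. So \<alpha> lies in the boundary of this closed
  set, which gives meagerness, and uniformly porous sets are negligible by Vitali's covering theorem.
\<close>

section \<open>Uniformly porous sets have measure zero\<close>

text \<open>Vitali's theorem covers almost all of \<open>S\<close> by disjoint balls inside an open
  \<open>T\<close> with \<open>T - S\<close> of measure below \<open>e\<close>. The holes occupy the
  fixed proportion \<open>c ^ DIM('a)\<close> of these balls and lie in \<open>T - S\<close>, so
  this proportion of the measure of \<open>S\<close> is at most \<open>e\<close>, for every
  \<open>e > 0\<close>.\<close>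

lemma porous_imp_negligible:
  fixes S :: "'a::euclidean_space set"
  assumes S: "S \<in> sets lebesgue" and c: "c > 0"
    and porous: "\<And>x d. x \<in> S \<Longrightarrow> d > 0 \<Longrightarrow>
      \<exists>r y. 0 < r \<and> r < d \<and> ball y (c * r) \<subseteq> ball x r \<and> ball y (c * r) \<inter> S = {}"
  shows "negligible S"
proof -
  let ?n = "DIM('a)"
  have bound: "ennreal (c ^ ?n) * emeasure lebesgue S \<le> ennreal e" if "e > 0" for e
  proof -
    obtain T where T: "open T" "S \<subseteq> T" "T - S \<in> lmeasurable"
      "emeasure lebesgue (T - S) < ennreal e"
      using sets_lebesgue_outer_open[OF S \<open>e > 0\<close>] by metis
    define K where "K = {(x, r, y). 0 < r \<and> ball x r \<subseteq> T \<and>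
      ball y (c * r) \<subseteq> ball x r \<and> ball y (c * r) \<inter> S = {}}"
    define ctr :: "'a \<times> real \<times> 'a \<Rightarrow> 'a" where "ctr = fst"
    define rad :: "'a \<times> real \<times> 'a \<Rightarrow> real" where "rad i = fst (snd i)" for i
    define hole :: "'a \<times> real \<times> 'a \<Rightarrow> 'a set" where "hole i = ball (snd (snd i)) (c * rad i)" for i
    have K: "0 < rad i" "ball (ctr i) (rad i) \<subseteq> T" "hole i \<subseteq> ball (ctr i) (rad i)"
      "hole i \<inter> S = {}" if "i \<in> K" for i
      using that by (auto simp: K_def ctr_def rad_def hole_def)
    have cover: "\<exists>i. i \<in> K \<and> x \<in> ball (ctr i) (rad i) \<and> rad i < d" if "x \<in> S" "0 < d" for x d
    proof -
      obtain \<delta> where \<delta>: "\<delta> > 0" "ball x \<delta> \<subseteq> T"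
        using T \<open>x \<in> S\<close> openE by blast
      obtain r y where ry: "0 < r" "r < min d \<delta>" "ball y (c * r) \<subseteq> ball x r"
        "ball y (c * r) \<inter> S = {}"
        \<comment> \<open>The bound \<open>d\<close> gives the arbitrarily small radii that Vitali's
          theorem asks for; the bound \<open>\<delta>\<close> keeps the ball inside
          \<open>T\<close>.\<close>
        using porous[OF \<open>x \<in> S\<close>, of "min d \<delta>"] \<open>0 < d\<close> \<delta>(1) by auto
      moreover have "ball x r \<subseteq> T"
        using \<delta>(2) ry(2) subset_ball[of r \<delta> x] by auto
      ultimately have "(x, r, y) \<in> K"
        by (simp add: K_def)
      then show ?thesis
        using ry(1,2) by (intro exI[of _ "(x, r, y)"]) (auto simp: ctr_def rad_def)
    qed
    obtain C where C: "countable C" "C \<subseteq> K"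
      "pairwise (\<lambda>i j. disjnt (ball (ctr i) (rad i)) (ball (ctr j) (rad j))) C"
      "negligible (S - (\<Union>i\<in>C. ball (ctr i) (rad i)))"
      by (rule Vitali_covering_theorem_balls[of S K ctr rad, OF cover])
    let ?U = "\<Union>i\<in>C. ball (ctr i) (rad i)"
    let ?H = "\<Union>i\<in>C. hole i"
    have scale: "emeasure lebesgue (hole i) = ennreal (c ^ ?n) * emeasure lebesgue (ball (ctr i) (rad i))"
      if "i \<in> C" for i
    proof -
      have "0 < rad i"
        using K(1) C(2) that by blast
      then show ?thesis
        using c emeasure_lebesgue_ball_conv_unit_ball[of "c * rad i" "snd (snd i)"]
          emeasure_lebesgue_ball_conv_unit_ball[of "rad i" "ctr i"]
        by (simp add: hole_def power_mult_distrib ennreal_mult mult.assoc)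
    qed
    have disjU: "disjoint_family_on (\<lambda>i. ball (ctr i) (rad i)) C"
      using C(3) by (auto simp: disjoint_family_on_def pairwise_def disjnt_def)
    have disjH: "disjoint_family_on hole C"
      using disjU K(3) C(2) unfolding disjoint_family_on_def by blast
    have "emeasure lebesgue S \<le> emeasure lebesgue (?U \<union> (S - ?U))"
      using S C(1) by (intro emeasure_mono) (auto intro!: sets.Un sets.Diff sets.countable_UN')
    also have "\<dots> = emeasure lebesgue ?U"
    proof (rule emeasure_Un_null_set)
      show "?U \<in> sets lebesgue"
        using C(1) by (intro sets.countable_UN') auto
      show "S - ?U \<in> null_sets lebesgue"
        using C(4) by (simp add: negligible_iff_null_sets)
    qed
    finally have "ennreal (c ^ ?n) * emeasure lebesgue S \<le> ennreal (c ^ ?n) * emeasure lebesgue ?U"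
      by (rule mult_left_mono) simp
    also have "\<dots> = ennreal (c ^ ?n) *
        (\<integral>\<^sup>+i. emeasure lebesgue (ball (ctr i) (rad i)) \<partial>count_space C)"
      using C(1) disjU by (subst emeasure_UN_countable) auto
    also have "\<dots> = (\<integral>\<^sup>+i. emeasure lebesgue (hole i) \<partial>count_space C)"
      by (subst nn_integral_cmult[symmetric]) (auto intro!: nn_integral_cong simp: scale)
    also have "\<dots> = emeasure lebesgue ?H"
      using C(1) disjH by (subst emeasure_UN_countable) (auto simp: hole_def)
    also have "\<dots> \<le> emeasure lebesgue (T - S)"
    proof (rule emeasure_mono)
      show "?H \<subseteq> T - S"
        using K(2-4) C(2) by blast
    qed (rule fmeasurableD[OF T(3)])
    also have "\<dots> \<le> ennreal e"
      using T(4) by simp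
    finally show ?thesis .
  qed
  have "ennreal (c ^ ?n) * emeasure lebesgue S \<le> 0"
    by (rule ennreal_le_epsilon) (use bound in auto)
  then have "emeasure lebesgue S = 0"
    using c zero_less_power[OF c, of ?n] by (simp add: ennreal_eq_0_iff not_le)
  then show ?thesis
    using S by (simp add: negligible_iff_null_sets null_setsI)
qed

section \<open>The projection of a fixed point as a function of the direction\<close>

lemma Phi_continuous [continuous_intros]: "continuous_on A (\<lambda>\<beta>. Phi \<beta> x)"
  unfolding Phi_def by (intro continuous_intros)

lemma Phi_lipschitz: "\<bar>Phi \<beta> x - Phi \<gamma> x\<bar> \<le> 2 * norm x * \<bar>\<beta> - \<gamma>\<bar>"
proof -
  have cos: "\<bar>cos \<beta> - cos \<gamma>\<bar> \<le> \<bar>\<beta> - \<gamma>\<bar>"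
  proof -
    have "norm (cos \<beta> - cos \<gamma>) \<le> 1 * norm (\<beta> - \<gamma>)"
      by (rule field_differentiable_bound[where S = UNIV and f' = "\<lambda>x. - sin x"])
         (auto intro!: derivative_eq_intros)
    then show ?thesis by simp
  qed
  have sin: "\<bar>sin \<beta> - sin \<gamma>\<bar> \<le> \<bar>\<beta> - \<gamma>\<bar>"
  proof -
    have "norm (sin \<beta> - sin \<gamma>) \<le> 1 * norm (\<beta> - \<gamma>)"
      by (rule field_differentiable_bound[where S = UNIV and f' = cos])
         (auto intro!: derivative_eq_intros)
    then show ?thesis by simp
  qed
  have "Phi \<beta> x - Phi \<gamma> x = x $ 1 * (cos \<beta> - cos \<gamma>) + x $ 2 * (sin \<beta> - sin \<gamma>)"
    by (simp add: Phi_def algebra_simps)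
  also have "\<bar>\<dots>\<bar> \<le> \<bar>x $ 1\<bar> * \<bar>cos \<beta> - cos \<gamma>\<bar> + \<bar>x $ 2\<bar> * \<bar>sin \<beta> - sin \<gamma>\<bar>"
    by (metis abs_mult abs_triangle_ineq)
  also have "\<dots> \<le> norm x * \<bar>\<beta> - \<gamma>\<bar> + norm x * \<bar>\<beta> - \<gamma>\<bar>"
    by (intro add_mono mult_mono sin cos component_le_norm_cart) auto
  finally show ?thesis by simp
qed

text \<open>By the mean value theorem, since the derivative \<open>cos\<close> is at least
  \<open>cos (pi / 3) = 1 / 2\<close> on \<open>[0, 1]\<close>.\<close>

lemma half_le_sin:
  fixes t :: real
  assumes "0 \<le> t" "t \<le> 1"
  shows "t / 2 \<le> sin t"
proof (cases "t = 0")
  case False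
  then obtain z where z: "0 < z" "z < t" "sin t - sin 0 = (t - 0) * cos z"
    using MVT2[of 0 t sin cos] assms by (auto intro: DERIV_sin)
  have "cos (pi / 3) \<le> cos z"
    using z assms pi_gt3 by (intro cos_monotone_0_pi_le) auto
  then have "t * (1 / 2) \<le> t * cos z"
    using assms by (intro mult_left_mono) (auto simp: cos_60)
  then show ?thesis
    using z(3) by simp
qed simp

text \<open>The map \<beta> to \<open>Phi \<beta> x\<close> is a sinusoid of amplitude
  \<open>norm x\<close>. As its value at \<alpha> is small against this amplitude, its slope there
  is large, so short rotations to both sides carry it past \<open>r\<close> and \<open>- r\<close>;
  the intermediate value theorem then yields \<open>m\<close>.\<close>

lemma Phi_attains:
  assumes R: "norm x \<ge> 8 * r" and r: "r > 0" and \<alpha>: "\<bar>Phi \<alpha> x\<bar> \<le> r" and m: "\<bar>m\<bar> \<le> r"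
  shows "\<exists>\<beta>. \<bar>\<beta> - \<alpha>\<bar> \<le> 8 * r / norm x \<and> Phi \<beta> x = m"
proof -
  define R where "R = norm x"
  \<comment> \<open>\<open>g\<close> is the derivative of \<open>Phi \<beta> x\<close> in \<beta> at
    \<alpha>. Together with \<open>Phi \<alpha> x\<close> it gives the coordinates of
    \<open>x\<close> in the rotated orthonormal frame, so their squares sum to the square of
    \<open>R\<close>.\<close>
  define g where "g = x $ 2 * cos \<alpha> - x $ 1 * sin \<alpha>"
  \<comment> \<open>With \<open>\<bar>g\<bar> \<ge> R / 2\<close> and
    \<open>sin \<delta> \<ge> \<delta> / 2\<close> this makes
    \<open>\<bar>g\<bar> * sin \<delta>\<close> at least \<open>2 * r\<close>, enough to outweigh
    both the cosine term and \<open>m\<close>, each at most \<open>r\<close> in absolute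
    value.\<close>
  define \<delta> where "\<delta> = 8 * r / R"
  have R0: "R > 0" "8 * r \<le> R"
    using R r by (auto simp: R_def)
  have \<delta>: "0 < \<delta>" "\<delta> \<le> 1"
    using R0 r by (auto simp: \<delta>_def)
  have "R\<^sup>2 = (x $ 1)\<^sup>2 + (x $ 2)\<^sup>2"
    by (simp add: R_def norm_vec_def L2_set_def sum_2)
  also have "\<dots> = ((x $ 1)\<^sup>2 + (x $ 2)\<^sup>2) * ((sin \<alpha>)\<^sup>2 + (cos \<alpha>)\<^sup>2)"
    by simp
  also have "\<dots> = (Phi \<alpha> x)\<^sup>2 + g\<^sup>2"
    unfolding Phi_def g_def by algebra
  finally have eq: "R\<^sup>2 = (Phi \<alpha> x)\<^sup>2 + g\<^sup>2" .
  have "(Phi \<alpha> x)\<^sup>2 \<le> (R / 8)\<^sup>2"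
    using \<alpha> R0 by (intro power2_le_iff_abs_le[THEN iffD2]) auto
  then have "(R / 2)\<^sup>2 \<le> g\<^sup>2"
    using eq by (simp add: power_divide) (use zero_le_power2[of R] in linarith)
  then have g: "R / 2 \<le> \<bar>g\<bar>"
    using R0 by (metis abs_le_square_iff abs_of_nonneg divide_nonneg_nonneg less_imp_le zero_le_numeral)
  have sd: "4 * r / R \<le> sin \<delta>"
    using half_le_sin[of \<delta>] \<delta> by (simp add: \<delta>_def)
  have "R / 2 * (4 * r / R) \<le> \<bar>g\<bar> * sin \<delta>"
    using g sd R0 r by (intro mult_mono) auto
  then have gs: "2 * r \<le> \<bar>g\<bar> * sin \<delta>"
    using R0 by simp
  have fc: "\<bar>Phi \<alpha> x * cos \<delta>\<bar> \<le> r"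
  proof -
    have "\<bar>Phi \<alpha> x * cos \<delta>\<bar> \<le> r * 1"
      unfolding abs_mult using \<alpha> r by (intro mult_mono) auto
    then show ?thesis by simp
  qed
  have plus: "Phi (\<alpha> + \<delta>) x = Phi \<alpha> x * cos \<delta> + g * sin \<delta>"
    and minus: "Phi (\<alpha> - \<delta>) x = Phi \<alpha> x * cos \<delta> - g * sin \<delta>"
    by (simp_all add: Phi_def g_def cos_add sin_add cos_diff sin_diff algebra_simps)
  have "\<exists>\<beta>. \<alpha> - \<delta> \<le> \<beta> \<and> \<beta> \<le> \<alpha> + \<delta> \<and> Phi \<beta> x = m"
  proof (cases "g \<ge> 0")
    case True
    then have "Phi (\<alpha> - \<delta>) x \<le> m" "m \<le> Phi (\<alpha> + \<delta>) x"
      using plus minus fc gs m by auto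
    then show ?thesis
      using \<delta> by (intro IVT') (auto intro: continuous_intros)
  next
    case False
    then have "Phi (\<alpha> + \<delta>) x \<le> m" "m \<le> Phi (\<alpha> - \<delta>) x"
      using plus minus fc gs m by auto
    then show ?thesis
      using \<delta> by (intro IVT2') (auto intro: continuous_intros)
  qed
  then obtain \<beta> where "\<alpha> - \<delta> \<le> \<beta>" "\<beta> \<le> \<alpha> + \<delta>" "Phi \<beta> x = m"
    by blast
  then show ?thesis
    by (intro exI[of _ \<beta>]) (auto simp: \<delta>_def R_def abs_le_iff)
qed

section \<open>Directions missing an interval, and recurrent directions\<close>

text \<open>Taken in the whole real line and with a non-strict inequality, so that the set is closed
  there.\<close>

definition missing :: "(real ^ 2) set \<Rightarrow> real \<Rightarrow> real \<Rightarrow> real set" where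
  "missing M m h = {\<beta>. \<forall>x\<in>M. h \<le> \<bar>Phi \<beta> x - m\<bar>}"

text \<open>Recurrence asks for points of arbitrarily large norm, since the scale of the holes is
  inversely proportional to the norm.\<close>

definition recurrent :: "(real ^ 2) set \<Rightarrow> real \<Rightarrow> real set" where
  "recurrent M r = {\<beta>. \<forall>n::nat. \<exists>x\<in>M. real n < norm x \<and> \<bar>Phi \<beta> x\<bar> \<le> r}"

lemma closed_missing: "closed (missing M m h)"
proof -
  have "missing M m h = (\<Inter>x\<in>M. {\<beta>. h \<le> \<bar>Phi \<beta> x - m\<bar>})"
    by (auto simp: missing_def)
  then show ?thesis
    by (auto intro!: closed_INT closed_Collect_le continuous_intros)
qed

lemma countable_discrete_set:
  assumes "discrete_set M"
  shows "countable M"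
proof -
  have "finite (M \<inter> {x. norm x \<le> real (Suc n)})" for n
    using assms unfolding discrete_set_def by (metis of_nat_0_less_iff zero_less_Suc)
  then have "countable (\<Union>n::nat. M \<inter> {x. norm x \<le> real (Suc n)})"
    by (intro countable_UN countable_finite countableI_type)
  moreover have "M \<subseteq> (\<Union>n::nat. M \<inter> {x. norm x \<le> real (Suc n)})"
  proof
    fix x assume "x \<in> M"
    moreover obtain n :: nat where "norm x \<le> real n"
      using real_arch_simple by blast
    ultimately show "x \<in> (\<Union>n::nat. M \<inter> {x. norm x \<le> real (Suc n)})"
      by (auto intro!: exI[of _ n])
  qed
  ultimately show ?thesis
    by (rule countable_subset[rotated])
qed

text \<open>For countable \<open>M\<close> the set is a countable intersection of countable unions
  of closed sets. This supplies the measurability needed in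
  \<open>porous_imp_negligible\<close>.\<close>

lemma borel_recurrent:
  assumes "countable M"
  shows "recurrent M r \<in> sets borel"
proof -
  have "recurrent M r = (\<Inter>n::nat. \<Union>x\<in>{x\<in>M. real n < norm x}. {\<beta>. \<bar>Phi \<beta> x\<bar> \<le> r})"
    by (auto simp: recurrent_def)
  moreover have "{\<beta>. \<bar>Phi \<beta> x\<bar> \<le> r} \<in> sets borel" for x
    by (intro borel_closed closed_Collect_le continuous_intros)
  moreover have "countable {x\<in>M. real n < norm x}" for n
    using assms by (rule countable_subset[rotated]) auto
  ultimately show ?thesis
    by (auto intro!: sets.countable_INT'' sets.countable_UN')
qed

section \<open>Porosity and its two consequences\<close>

text \<open>A far point \<open>x\<close> of \<open>M\<close> takes the value \<open>m\<close> at
  some \<beta> near \<alpha>, and the Lipschitz bound keeps its projection within \<open>h\<close>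
  of \<open>m\<close> on a ball around \<beta>. Both the distance and the radius scale like
  \<open>1 / norm x\<close>, so their ratio is independent of \<alpha> and \<open>x\<close>.\<close>

lemma missing_porous:
  assumes \<alpha>: "\<alpha> \<in> recurrent M r" and h: "0 < h" and r: "0 < r" "\<bar>m\<bar> + h \<le> r" and d: "0 < d"
  shows "\<exists>\<rho> \<beta>. 0 < \<rho> \<and> \<rho> < d \<and> ball \<beta> (h / (18 * r) * \<rho>) \<subseteq> ball \<alpha> \<rho> \<and>
    ball \<beta> (h / (18 * r) * \<rho>) \<inter> missing M m h = {}"
proof -
  \<comment> \<open>The bound \<open>8 * r\<close> makes \<open>Phi_attains\<close> applicable; the
    bound \<open>9 * r / d\<close> gives \<open>\<rho> < d\<close>.\<close>
  obtain n :: nat where n: "max (8 * r) (9 * r / d) < real n"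
    using reals_Archimedean2 by blast
  obtain x where x: "x \<in> M" "real n < norm x" "\<bar>Phi \<alpha> x\<bar> \<le> r"
    using \<alpha> by (auto simp: recurrent_def)
  define R where "R = norm x"
  have R: "8 * r < R" "9 * r / d < R" "0 < R"
    using n x(2) r by (auto simp: R_def)
  obtain \<beta> where \<beta>: "\<bar>\<beta> - \<alpha>\<bar> \<le> 8 * r / R" "Phi \<beta> x = m"
    using Phi_attains[of r x \<alpha> m] R r x(3) h by (auto simp: R_def)
  \<comment> \<open>Room for the offset of \<beta>, at most \<open>8 * r / R\<close>, and for the
    hole radius \<open>h / (2 * R)\<close>, at most \<open>r / R\<close>.\<close>
  define \<rho> where "\<rho> = 9 * r / R"
  have \<rho>: "0 < \<rho>" "\<rho> < d" "h / (18 * r) * \<rho> = h / (2 * R)"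
    using R r d by (auto simp: \<rho>_def field_simps)
  have "h / (2 * R) \<le> r / R"
    using R r h by (auto simp: field_simps)
  then have "8 * r / R + h / (2 * R) \<le> \<rho>"
    by (simp add: \<rho>_def field_simps)
  then have "ball \<beta> (h / (2 * R)) \<subseteq> ball \<alpha> \<rho>"
    using \<beta>(1) by (auto simp: dist_real_def)
  moreover have "\<gamma> \<notin> missing M m h" if "\<gamma> \<in> ball \<beta> (h / (2 * R))" for \<gamma>
  proof -
    have "\<bar>Phi \<gamma> x - m\<bar> \<le> 2 * R * \<bar>\<gamma> - \<beta>\<bar>"
      using Phi_lipschitz[of \<gamma> x \<beta>] \<beta>(2) by (simp add: R_def)
    also have "\<dots> < 2 * R * (h / (2 * R))"
      using that R by (intro mult_strict_left_mono) (auto simp: dist_real_def)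
    also have "\<dots> = h"
      using R by simp
    finally show ?thesis
      using x(1) by (force simp: missing_def)
  qed
  ultimately show ?thesis
    using \<rho> by (intro exI[of _ \<rho>] exI[of _ \<beta>]) auto
qed

lemma negligible_missing_recurrent:
  assumes "countable M" "0 < h" "0 < r" "\<bar>m\<bar> + h \<le> r"
  shows "negligible (missing M m h \<inter> recurrent M r)"
proof (rule porous_imp_negligible)
  show "missing M m h \<inter> recurrent M r \<in> sets lebesgue"
    using assms(1) by (intro sets.Int sets_completionI_sets)
      (auto intro: borel_recurrent borel_closed closed_missing)
  show "0 < h / (18 * r)"
    using assms by simp
  show "\<exists>\<rho> \<beta>. 0 < \<rho> \<and> \<rho> < d \<and> ball \<beta> (h / (18 * r) * \<rho>) \<subseteq> ball \<alpha> \<rho> \<and>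
      ball \<beta> (h / (18 * r) * \<rho>) \<inter> (missing M m h \<inter> recurrent M r) = {}"
    if "\<alpha> \<in> missing M m h \<inter> recurrent M r" "0 < d" for \<alpha> d
    using missing_porous[of \<alpha> M r h m d] that assms by blast
qed

text \<open>
  The half-open interval \<open>directions\<close> contains its left endpoint, where holes of the porous set may
  fall outside; this is harmless because its interior is dense in it.
\<close>

lemma nowhere_dense_missing_recurrent:
  assumes h: "0 < h" "0 < r" "\<bar>m\<bar> + h \<le> r"
    and N: "N \<subseteq> directions" "N \<subseteq> missing M m h \<inter> recurrent M r"
  shows "nowhere_dense_in (top_of_set directions) N"
proof -
  let ?X = "top_of_set directions"
  have "V = {}" if V: "openin ?X V" "V \<subseteq> ?X closure_of N" for V
  proof (rule ccontr)
    assume "V \<noteq> {}"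
    obtain W where W: "open W" "V = W \<inter> directions"
      using V(1) by (auto simp: openin_open)
    have cl: "?X closure_of N \<subseteq> closure N"
      using closure_mono[of "directions \<inter> N" N] by (auto simp: closure_of_subtopology)
    define W' where "W' = W \<inter> {0<..<2 * pi}"
    have "open W'" "W' \<subseteq> V"
      using W by (auto simp: W'_def directions_def)
    have "{0..<2 * pi} \<subseteq> closure {0<..<2 * pi}"
      using pi_gt_zero by (subst closure_greaterThanLessThan) auto
    then have "W \<inter> closure {0<..<2 * pi} \<noteq> {}"
      using \<open>V \<noteq> {}\<close> W by (auto simp: directions_def)
    then have "W' \<noteq> {}"
      unfolding W'_def using open_Int_closure_eq_empty[OF W(1)] by blast
    then have "W' \<inter> closure N \<noteq> {}"
      using \<open>W' \<subseteq> V\<close> V(2) cl by blast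
    then obtain \<alpha> where \<alpha>: "\<alpha> \<in> W'" "\<alpha> \<in> N"
      using open_Int_closure_eq_empty[OF \<open>open W'\<close>] by blast
    obtain d where d: "0 < d" "ball \<alpha> d \<subseteq> W'"
      using \<alpha>(1) \<open>open W'\<close> openE by blast
    \<comment> \<open>Only the closed factor \<open>missing M m h\<close> survives passing to the
      closure. The recurrence needed for a hole comes from \<alpha>, which was chosen in
      \<open>N\<close> itself.\<close>
    have "closure N \<subseteq> missing M m h"
      using N(2) by (intro closure_minimal closed_missing) auto
    then have sub: "ball \<alpha> d \<subseteq> missing M m h"
      using d(2) \<open>W' \<subseteq> V\<close> V(2) cl by blast
    obtain \<rho> \<beta> where \<rho>: "0 < \<rho>" "\<rho> < d" "ball \<beta> (h / (18 * r) * \<rho>) \<subseteq> ball \<alpha> \<rho>"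
      "ball \<beta> (h / (18 * r) * \<rho>) \<inter> missing M m h = {}"
      using missing_porous[of \<alpha> M r h m d] \<alpha>(2) N(2) h d(1) by blast
    have "\<beta> \<in> ball \<beta> (h / (18 * r) * \<rho>)"
      using \<rho>(1) h by simp
    moreover from this have "\<beta> \<in> missing M m h"
      using \<rho>(2,3) sub subset_ball[of \<rho> d \<alpha>] by (meson less_imp_le subsetD)
    ultimately show False
      using \<rho>(4) by blast
  qed
  then have "?X interior_of (?X closure_of N) = {}"
    by (simp add: interior_of_eq_empty)
  then show ?thesis
    using N(1) by (simp add: nowhere_dense_in_def)
qed

section \<open>Covering the exceptional directions\<close>

text \<open>Infinitely many projected values in a bounded interval cannot all come from a bounded
  part of \<open>M\<close>, which is finite. Allowing every larger \<open>s\<close> leaves freedom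
  to enlarge the bound later.\<close>

lemma not_discrete_imp_recurrent:
  assumes M: "discrete_set M" and "\<not> discrete_set (Phi \<alpha> ` M)"
  shows "\<exists>r. \<forall>s\<ge>r. \<alpha> \<in> recurrent M s"
proof -
  obtain r where r: "infinite (Phi \<alpha> ` M \<inter> {y. norm y \<le> r})"
    using assms(2) by (auto simp: discrete_set_def)
  have "\<alpha> \<in> recurrent M s" if "r \<le> s" for s
    unfolding recurrent_def
  proof (intro CollectI allI)
    fix n :: nat
    show "\<exists>x\<in>M. real n < norm x \<and> \<bar>Phi \<alpha> x\<bar> \<le> s"
    proof (rule ccontr)
      assume neg: "\<not> ?thesis"
      \<comment> \<open>The radius is \<open>Suc n\<close> because \<open>discrete_set\<close>
        speaks of positive radii and \<open>n\<close> may be 0.\<close>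
      have "Phi \<alpha> ` M \<inter> {y. norm y \<le> r} \<subseteq> Phi \<alpha> ` (M \<inter> {x. norm x \<le> real (Suc n)})"
        using neg that by fastforce
      moreover have "finite (M \<inter> {x. norm x \<le> real (Suc n)})"
        using M by (auto simp: discrete_set_def)
      ultimately show False
        using r finite_subset by blast
    qed
  qed
  then show ?thesis
    by blast
qed

lemma not_dense_imp_missing:
  assumes "closure (Phi \<alpha> ` M) \<noteq> UNIV"
  obtains m h where "m \<in> \<rat>" "h \<in> \<rat>" "0 < h" "\<alpha> \<in> missing M m h"
proof -
  obtain y where "y \<in> - closure (Phi \<alpha> ` M)"
    using assms by auto
  then obtain e where e: "0 < e" "ball y e \<subseteq> - closure (Phi \<alpha> ` M)"
    by (meson closed_closure open_Compl openE)
  \<comment> \<open>Centre and half-width each use less than \<open>e / 2\<close>, so the rational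
    interval stays inside \<open>ball y e\<close>.\<close>
  obtain m where m: "m \<in> \<rat>" "y < m" "m < y + e / 2"
    using Rats_dense_in_real[of y "y + e / 2"] e(1) by auto
  obtain h where h: "h \<in> \<rat>" "0 < h" "h < e / 2"
    using Rats_dense_in_real[of 0 "e / 2"] e(1) by auto
  have "h \<le> \<bar>Phi \<alpha> x - m\<bar>" if "x \<in> M" for x
  proof (rule ccontr)
    assume "\<not> ?thesis"
    then have "Phi \<alpha> x \<in> ball y e"
      using m h by (auto simp: dist_real_def)
    moreover have "Phi \<alpha> x \<in> closure (Phi \<alpha> ` M)"
      using that by (intro subsetD[OF closure_subset] imageI)
    ultimately show False
      using e(2) by blast
  qed
  then show thesis
    using that m(1) h(1,2) by (auto simp: missing_def)
qed

lemma exceptional_cover: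
  assumes "discrete_set M" "\<alpha> \<in> exceptional M"
  obtains m h r where "m \<in> \<rat>" "h \<in> \<rat>" "r \<in> \<rat>" "0 < h" "0 < r" "\<bar>m\<bar> + h \<le> r"
    "\<alpha> \<in> missing M m h \<inter> recurrent M r"
proof -
  have nd: "closure (Phi \<alpha> ` M) \<noteq> UNIV" "\<not> discrete_set (Phi \<alpha> ` M)"
    using assms(2) by (auto simp: exceptional_def DEN_def DIS_def)
  obtain m h where mh: "m \<in> \<rat>" "h \<in> \<rat>" "0 < h" "\<alpha> \<in> missing M m h"
    using not_dense_imp_missing[OF nd(1)] .
  obtain s where s: "\<And>r. s \<le> r \<Longrightarrow> \<alpha> \<in> recurrent M r"
    using not_discrete_imp_recurrent[OF assms(1) nd(2)] by blast
  \<comment> \<open>A natural number serves as a rational bound above both the recurrence threshold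
    and \<open>\<bar>m\<bar> + h\<close>.\<close>
  obtain n :: nat where n: "max s (\<bar>m\<bar> + h) \<le> real n"
    using real_arch_simple by blast
  have "\<alpha> \<in> missing M m h \<inter> recurrent M (real n)"
    using mh(4) s[of "real n"] n by simp
  moreover have "0 < real n" "\<bar>m\<bar> + h \<le> real n"
    using n mh(3) by linarith+
  ultimately show thesis
    using that[OF mh(1,2) Rats_of_nat mh(3)] by blast
qed

section \<open>Countable union over rational parameters\<close>

theorem theorem1p1:
  fixes M :: "(real ^ 2) set"
  assumes "discrete_set M"
  shows "meager_in (top_of_set directions) (exceptional M)
    \<and> exceptional M \<in> null_sets lebesgue"
proof -
  define Q :: "(real \<times> real \<times> real) set"
    where "Q = {(m, h, r) \<in> \<rat> \<times> \<rat> \<times> \<rat>. 0 < h \<and> 0 < r \<and> \<bar>m\<bar> + h \<le> r}"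
  define P where "P = (\<lambda>(m, h, r). missing M m h \<inter> recurrent M r)"
  have Q: "countable Q"
  proof (rule countable_subset)
    show "Q \<subseteq> \<rat> \<times> \<rat> \<times> \<rat>"
      by (auto simp: Q_def)
    show "countable (\<rat> \<times> \<rat> \<times> \<rat> :: (real \<times> real \<times> real) set)"
      by (intro countable_SIGMA countable_rat)
  qed
  have sub: "exceptional M \<subseteq> (\<Union>q\<in>Q. P q)"
  proof
    fix \<alpha> assume "\<alpha> \<in> exceptional M"
    from exceptional_cover[OF assms this] show "\<alpha> \<in> (\<Union>q\<in>Q. P q)"
      by (fastforce simp: Q_def P_def)
  qed
  have "negligible (\<Union>q\<in>Q. P q)"
    using Q negligible_missing_recurrent[OF countable_discrete_set[OF assms]]
    by (intro negligible_countable_Union) (auto simp: Q_def P_def)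
  then have "negligible (exceptional M)"
    using sub negligible_subset by blast
  moreover have "meager_in (top_of_set directions) (exceptional M)"
    unfolding meager_in_def
  proof (intro exI conjI ballI)
    \<comment> \<open>The sets \<open>P q\<close> live in the whole line; intersecting with
      \<open>exceptional M\<close> puts them inside \<open>directions\<close> and makes their union
      exactly \<open>exceptional M\<close>, as \<open>meager_in\<close> demands.\<close>
    show "countable ((\<lambda>q. exceptional M \<inter> P q) ` Q)"
      using Q by simp
    show "exceptional M = \<Union>((\<lambda>q. exceptional M \<inter> P q) ` Q)"
      using sub by blast
    fix N assume "N \<in> (\<lambda>q. exceptional M \<inter> P q) ` Q"
    then obtain m h r where "0 < h" "0 < r" "\<bar>m\<bar> + h \<le> r"
      "N = exceptional M \<inter> (missing M m h \<inter> recurrent M r)"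
      by (auto simp: Q_def P_def)
    then show "nowhere_dense_in (top_of_set directions) N"
      by (intro nowhere_dense_missing_recurrent[of h r m]) (auto simp: exceptional_def)
  qed
  ultimately show ?thesis
    by (simp add: negligible_iff_null_sets)
qed

end
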